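(* Let $\varepsilon\ge 1$ be an integer. There exists an instance $I_2$ of the chance-constrained submodular problem of the following linear form: $V=\{1,\dots,n\}$ with $n\ge 2\varepsilon$, $0<\alpha<0.5$, $B=\varepsilon+1$, $f(X)=\sum_{i=1}^{\varepsilon}x_i+\varepsilon\sum_{i=\varepsilon+1}^{n}x_i$ (where $X=x_1\cdots x_n\in\{0,1\}^n$ encodes a subset of $V$, $x_i=1$ meaning that $i$ is selected), $\delta_i=\sqrt{\gamma/\varepsilon}$ for $1\le i\le\varepsilon$ and $\delta_j=\sqrt{(\varepsilon\gamma+\beta)/\varepsilon}$ for $\varepsilon+1\le j\le n$, with $\gamma>0$, $\beta>0$ and $\varepsilon\gamma+\beta\le 3\alpha/(1-\alpha)$, such that the generalized greedy algorithm GGA applying $h(S):=\sum_{i\in S}\delta_i^2$ fails to guarantee better than a $(1/\varepsilon)$-approximation on $I_2$.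
   Context: Chance-constrained submodular problem: $V=\{1,\dots,n\}$; $f:2^V\to\mathbb{R}_{\ge 0}$ is monotone and submodular; the budget is $B>1$; the threshold is $\alpha\in[0,1]$ ($\alpha>0$ whenever $\kappa_\alpha$ below is used). Each element $i\in V$ has a random weight $w_i$, independently and uniformly distributed on $[1-\delta_i,1+\delta_i]$ with $0\le\delta_i\le 1$, so $E[w_i]=1$ and $Var[w_i]=\delta_i^2/3$. Write $W(S)=\sum_{i\in S}w_i$. The aim is to maximize $f(S)$ over $S\subseteq V$ subject to $\Pr[W(S)>B]\le\alpha$. Every single element is assumed feasible with respect to $B$. Surrogate weight: $\Gamma(S)=E[W(S)]+\kappa_\alpha\sqrt{Var[W(S)]}=|S|+\kappa_\alpha\sqrt{\sum_{i\in S}\delta_i^2/3}$, where $\kappa_\alpha=\sqrt{(1-\alpha)/\alpha}$. Algorithm GGA (with a non-decreasing set function $h$): start with $S=\emptyset$, $V'=V$. While $V'\ne\emptyset$: pick $v^*\in\arg\max_{v\in V'}\frac{f(S\cup\{v\})-f(S)}{h(S\cup\{v\})-h(S)}$; if $\Gamma(S\cup\{v^*\})\le B$, set $S\leftarrow S\cup\{v^*\}$; then set $V'\leftarrow V'\setminus\{v^*\}$. After the loop, let $v^*\in\arg\max\{f(v): v\in V,\ \Pr[w_v>B]\le\alpha\}$ and output whichever of $S$ and $\{v^*\}$ has larger $f$-value. Let $OPT_d$ be an optimal solution of the deterministic instance, i.e. a maximizer of $f$ over sets of size at most $\lfloor B\rfloor$ (all weights equal to $1$). An algorithm "fails to guarantee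 better than an $r$-approximation" on an instance if some possible output $S$ of it on that instance satisfies $f(S)\le r\cdot f(OPT_d)$. *)

theory Defs
  imports "HOL-Probability.Probability"
begin

record cc_instance =
  ground_size :: nat
  objective :: "nat set \<Rightarrow> real"
  halfwidth :: "nat \<Rightarrow> real"
  budget :: real
  threshold :: real

definition ground :: "cc_instance \<Rightarrow> nat set" where
  "ground I = {1..ground_size I}"

text \<open>Uniform distribution on the interval from \<open>1 - d\<close> to \<open>1 + d\<close>. The degenerate case
  \<open>d = 0\<close> must be separate, since \<^const>\<open>uniform_measure\<close> on a null set is not a
  probability measure.\<close>

definition weight_distr :: "real \<Rightarrow> real measure" where
  "weight_distr d = (if d = 0 then return borel 1 else uniform_measure lborel {1 - d..1 + d})"

definition weight_space :: "cc_instance \<Rightarrow> (nat \<Rightarrow> real) measure" where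
  "weight_space I = PiM (ground I) (\<lambda>i. weight_distr (halfwidth I i))"

definition total_weight :: "nat set \<Rightarrow> (nat \<Rightarrow> real) \<Rightarrow> real" where
  "total_weight S w = (\<Sum>i\<in>S. w i)"

definition chance_feasible :: "cc_instance \<Rightarrow> nat set \<Rightarrow> bool" where
  "chance_feasible I S \<longleftrightarrow>
     \<P>(w in weight_space I. total_weight S w > budget I) \<le> threshold I"

definition mean_weight :: "cc_instance \<Rightarrow> nat set \<Rightarrow> real" where
  "mean_weight I S = (\<integral>w. total_weight S w \<partial>weight_space I)"

definition var_weight :: "cc_instance \<Rightarrow> nat set \<Rightarrow> real" where
  "var_weight I S = (\<integral>w. (total_weight S w - mean_weight I S)\<^sup>2 \<partial>weight_space I)"

definition kappa :: "real \<Rightarrow> real" where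
  "kappa \<alpha> = sqrt ((1 - \<alpha>) / \<alpha>)"

definition surrogate :: "cc_instance \<Rightarrow> nat set \<Rightarrow> real" where
  "surrogate I S = mean_weight I S + kappa (threshold I) * sqrt (var_weight I S)"

lemma weight_distr_moments:
  assumes "0 \<le> d"
  shows "prob_space (weight_distr d)" (is ?P)
    and "integrable (weight_distr d) (\<lambda>x. (x - 1) ^ k)" (is ?I)
    and "(\<integral>x. x - 1 \<partial>weight_distr d) = 0" (is ?E)
    and "(\<integral>x. (x - 1)\<^sup>2 \<partial>weight_distr d) = d\<^sup>2 / 3" (is ?V)
proof -
  have "?P \<and> ?I \<and> ?E \<and> ?V"
  proof (cases "d = 0")
    case True
    interpret prob_space "return borel (1::real)"
      by (rule prob_space_return) simp
    have "integrable (return borel (1::real)) (\<lambda>x. (x - 1) ^ k)"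
      by (rule integrable_const_bound[where B = 1]) (auto simp: AE_return power_0_left)
    then show ?thesis using True prob_space_axioms
      by (simp add: weight_distr_def integral_return)
  next
    case False
    with assms have d: "0 < d" by simp
    let ?A = "{1 - d..1 + d}"
    let ?M = "uniform_measure lborel ?A"
    have eA: "emeasure lborel ?A = ennreal (2 * d)" using d by simp
    interpret prob_space ?M
      by (rule prob_space_uniform_measure) (use d in \<open>auto simp: eA\<close>)
    have ae: "AE x in ?M. x \<in> ?A"
      by (rule AE_uniform_measureI) auto
    have I: "integrable ?M (\<lambda>x. (x - 1) ^ k)" for k
    proof (rule integrable_const_bound[where B = "d ^ k"])
      show "AE x in ?M. norm ((x - 1) ^ k) \<le> d ^ k"
        using ae by eventually_elim (simp only: real_norm_def power_abs, rule power_mono, auto)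
    qed simp
    have D: "distributed ?M lborel (\<lambda>x. x) (\<lambda>x. indicator ?A x / measure lborel ?A)"
      unfolding distributed_def
    proof safe
      have "distr ?M lborel (\<lambda>x. x) = ?M" by (rule distr_id2) simp
      also have "\<dots> = density lborel (\<lambda>x. ennreal (indicator ?A x / measure lborel ?A))"
        unfolding uniform_measure_def using d
        by (intro density_cong) (auto simp: eA indicator_def divide_ennreal[of 1, simplified])
      finally show "distr ?M lborel (\<lambda>x. x) = density lborel (\<lambda>x. ennreal (indicator ?A x / measure lborel ?A))" .
    qed auto
    have e1: "expectation (\<lambda>x. x) = 1"
      using uniform_distributed_expectation[OF D] by simp
    have v: "(\<integral>x. (x - 1)\<^sup>2 \<partial>?M) = d\<^sup>2 / 3"
      using uniform_distributed_variance[OF D] by (simp add: e1 power2_eq_square)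
    have i1: "integrable ?M (\<lambda>x. x)"
      using Bochner_Integration.integrable_add[OF I[of 1] integrable_const[of 1]] by simp
    have e: "(\<integral>x. x - 1 \<partial>?M) = 0"
      using i1 e1 prob_space by (subst Bochner_Integration.integral_diff) auto
    show ?thesis using False prob_space_axioms I[of k] e v by (simp add: weight_distr_def)
  qed
  then show ?P ?I ?E ?V by auto
qed

lemma weight_space_moments:
  assumes "\<forall>i\<in>ground I. 0 \<le> halfwidth I i" and S: "S \<subseteq> ground I"
  shows mean_weight_eq: "mean_weight I S = real (card S)"
    and var_weight_eq: "var_weight I S = (\<Sum>i\<in>S. (halfwidth I i)\<^sup>2 / 3)"
proof -
  let ?d = "\<lambda>i. max 0 (halfwidth I i)"
  let ?N = "\<lambda>i. weight_distr (?d i)"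
  let ?V = "ground I"
  let ?W = "PiM ?V ?N"
  have W: "weight_space I = ?W" unfolding weight_space_def
    by (rule PiM_cong) (use assms in auto)
  have d: "?d i = halfwidth I i" if "i \<in> S" for i using assms that by auto
  have fin: "finite ?V" "finite S" using S by (auto simp: ground_def intro: finite_subset)
  have pN: "prob_space (?N i)" for i by (rule weight_distr_moments) simp
  interpret product_prob_space ?N ?V
    using pN unfolding product_prob_space_def product_prob_space_axioms_def product_sigma_finite_def
    by (auto simp: prob_space_imp_sigma_finite)
  have pW: "prob_space ?W" by (rule prob_space_PiM) (rule pN)
  define g where "g i j k x = (x - 1) ^ (of_bool (k = i) + of_bool (k = j))" for i j k :: nat and x :: real
  have gp: "(\<Prod>k\<in>?V. g i j k (w k)) = (w i - 1) * (w j - 1)" if "i \<in> S" "j \<in> S" for i j w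
  proof -
    have "(\<Prod>k\<in>?V. (w k - 1) ^ of_bool (k = l)) = w l - 1" if "l \<in> S" for l
    proof -
      have "(\<Prod>k\<in>?V. (w k - 1) ^ of_bool (k = l)) = (\<Prod>k\<in>?V. if k = l then w k - 1 else 1)"
        by (rule prod.cong) auto
      then show ?thesis using fin that S by (auto simp: prod.delta)
    qed
    then show ?thesis using that by (simp add: g_def power_add prod.distrib)
  qed
  have gi: "integrable (?N k) (g i j k)" for i j k
    unfolding g_def by (rule weight_distr_moments) simp
  have int2: "integrable ?W (\<lambda>w. (w i - 1) * (w j - 1))" if "i \<in> S" "j \<in> S" for i j
    using product_integrable_prod[OF fin(1), of "g i j", OF gi] by (simp add: gp that)
  have gint: "(\<integral>x. g i j k x \<partial>?N k) =
      (if k = i \<and> k = j then (?d k)\<^sup>2 / 3 else if k = i \<or> k = j then 0 else 1)" for i j k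
    using weight_distr_moments(3,4)[of "?d k"] prob_space.prob_space[OF pN[of k]]
    by (auto simp: g_def power2_eq_square)
  have cov: "(\<integral>w. (w i - 1) * (w j - 1) \<partial>?W) = (if i = j then (?d i)\<^sup>2 / 3 else 0)"
    if ij: "i \<in> S" "j \<in> S" for i j
  proof -
    have "(\<integral>w. (w i - 1) * (w j - 1) \<partial>?W) = (\<Prod>k\<in>?V. \<integral>x. g i j k x \<partial>?N k)"
      using product_integral_prod[OF fin(1), of "g i j", OF gi] by (simp add: gp that)
    also have "\<dots> = (if i = j then (?d i)\<^sup>2 / 3 else 0)"
    proof (cases "i = j")
      case True
      then have "(\<Prod>k\<in>?V. \<integral>x. g i j k x \<partial>?N k) = (\<Prod>k\<in>?V. if k = i then (?d k)\<^sup>2 / 3 else 1)"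
        by (intro prod.cong) (auto simp: gint)
      also have "\<dots> = (?d i)\<^sup>2 / 3" using fin S ij by (subst prod.delta) auto
      finally show ?thesis using True by simp
    next
      case False
      then have "(\<integral>x. g i j i x \<partial>?N i) = 0" by (simp add: gint)
      then have "(\<Prod>k\<in>?V. \<integral>x. g i j k x \<partial>?N k) = 0" using fin S ij by (intro prod_zero) auto
      then show ?thesis using False by simp
    qed
    finally show ?thesis .
  qed
  have Ni: "integrable (?N i) (\<lambda>x. x - 1)" for i
    using weight_distr_moments(2)[of "?d i" 1] by simp
  have D: "distr ?W (?N i) (\<lambda>w. w i) = ?N i" if "i \<in> S" for i
    using that S by (intro distr_PiM_component pN) auto
  have meas: "(\<lambda>w. w i) \<in> measurable ?W (?N i)" if "i \<in> S" for i
    using that S by (intro measurable_component_singleton) auto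
  have int1: "integrable ?W (\<lambda>w. w i - 1)" and exp1: "(\<integral>w. w i - 1 \<partial>?W) = 0" if "i \<in> S" for i
  proof -
    have m: "(\<lambda>x. x - 1) \<in> borel_measurable (?N i)" using Ni by blast
    show "integrable ?W (\<lambda>w. w i - 1)"
      using Ni[of i] integrable_distr_eq[OF meas[OF that] m] D[OF that] by simp
    show "(\<integral>w. w i - 1 \<partial>?W) = 0"
      using integral_distr[OF meas[OF that] m] D[OF that] weight_distr_moments(3)[of "?d i"] by simp
  qed
  have tw: "total_weight S w = (\<Sum>i\<in>S. w i - 1) + real (card S)" for w
    by (simp add: total_weight_def sum_subtractf)
  have mean: "mean_weight I S = real (card S)"
    unfolding mean_weight_def W tw
    using int1 exp1 prob_space.prob_space[OF pW] prob_space.emeasure_space_1[OF pW]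
    by (subst Bochner_Integration.integral_add) (auto simp: Bochner_Integration.integral_sum)
  then show "mean_weight I S = real (card S)" .
  have "var_weight I S = (\<integral>w. (\<Sum>i\<in>S. \<Sum>j\<in>S. (w i - 1) * (w j - 1)) \<partial>?W)"
    unfolding var_weight_def mean W tw by (simp add: power2_eq_square sum_product)
  also have "\<dots> = (\<Sum>i\<in>S. \<Sum>j\<in>S. if i = j then (?d i)\<^sup>2 / 3 else 0)"
    using int2 by (simp add: Bochner_Integration.integral_sum cov)
  also have "\<dots> = (\<Sum>i\<in>S. (halfwidth I i)\<^sup>2 / 3)"
    using fin d by (intro sum.cong) (auto simp: sum.delta)
  finally show "var_weight I S = (\<Sum>i\<in>S. (halfwidth I i)\<^sup>2 / 3)" .
qed

lemma surrogate_eq: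
  assumes "\<forall>i\<in>ground I. 0 \<le> halfwidth I i" and "S \<subseteq> ground I"
  shows "surrogate I S =
    real (card S) + kappa (threshold I) * sqrt (\<Sum>i\<in>S. (halfwidth I i)\<^sup>2 / 3)"
  unfolding surrogate_def using weight_space_moments[OF assms] by simp

definition monotone_set_fun :: "'a set \<Rightarrow> ('a set \<Rightarrow> real) \<Rightarrow> bool" where
  "monotone_set_fun V f \<longleftrightarrow> (\<forall>X Y. X \<subseteq> Y \<and> Y \<subseteq> V \<longrightarrow> f X \<le> f Y)"

definition submodular :: "'a set \<Rightarrow> ('a set \<Rightarrow> real) \<Rightarrow> bool" where
  "submodular V f \<longleftrightarrow>
     (\<forall>X Y. X \<subseteq> V \<and> Y \<subseteq> V \<longrightarrow> f (X \<union> Y) + f (X \<inter> Y) \<le> f X + f Y)"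

definition valid_instance :: "cc_instance \<Rightarrow> bool" where
  "valid_instance I \<longleftrightarrow>
     (\<forall>S. S \<subseteq> ground I \<longrightarrow> 0 \<le> objective I S) \<and>
     monotone_set_fun (ground I) (objective I) \<and>
     submodular (ground I) (objective I) \<and>
     1 < budget I \<and>
     0 \<le> threshold I \<and> threshold I \<le> 1 \<and>
     (\<forall>i\<in>ground I. 0 \<le> halfwidth I i \<and> halfwidth I i \<le> 1) \<and>
     (\<forall>i\<in>ground I. chance_feasible I {i})"

text \<open>For zero marginal cost the quotient is \<open>0\<close> by the convention for division; this does
  not arise for strictly increasing cost functions \<open>h\<close>.\<close>

definition gain_ratio ::
  "cc_instance \<Rightarrow> (nat set \<Rightarrow> real) \<Rightarrow> nat set \<Rightarrow> nat \<Rightarrow> real" where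
  "gain_ratio I h S v =
     (objective I (S \<union> {v}) - objective I S) / (h (S \<union> {v}) - h S)"

text \<open>\<open>gga_reach I h S V'\<close>: some tie-breaking leads the main loop to current solution \<open>S\<close> and
  remaining candidates \<open>V'\<close>.\<close>

inductive gga_reach ::
  "cc_instance \<Rightarrow> (nat set \<Rightarrow> real) \<Rightarrow> nat set \<Rightarrow> nat set \<Rightarrow> bool"
  for I h where
  start: "gga_reach I h {} (ground I)"
| add: "gga_reach I h S V' \<Longrightarrow> is_arg_max (gain_ratio I h S) (\<lambda>v. v \<in> V') v \<Longrightarrow>
    surrogate I (S \<union> {v}) \<le> budget I \<Longrightarrow> gga_reach I h (S \<union> {v}) (V' - {v})"
| skip: "gga_reach I h S V' \<Longrightarrow> is_arg_max (gain_ratio I h S) (\<lambda>v. v \<in> V') v \<Longrightarrow>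
    \<not> surrogate I (S \<union> {v}) \<le> budget I \<Longrightarrow> gga_reach I h S (V' - {v})"

definition gga_output :: "cc_instance \<Rightarrow> (nat set \<Rightarrow> real) \<Rightarrow> nat set \<Rightarrow> bool" where
  "gga_output I h T \<longleftrightarrow>
     (\<exists>S v. gga_reach I h S {} \<and>
        is_arg_max (\<lambda>v. objective I {v}) (\<lambda>v. v \<in> ground I \<and> chance_feasible I {v}) v \<and>
        is_arg_max (objective I) (\<lambda>X. X \<in> {S, {v}}) T)"

definition det_optimal :: "cc_instance \<Rightarrow> nat set \<Rightarrow> bool" where
  "det_optimal I T \<longleftrightarrow>
     is_arg_max (objective I) (\<lambda>S. S \<subseteq> ground I \<and> int (card S) \<le> \<lfloor>budget I\<rfloor>) T"

text \<open>The predicate \<open>out\<close> describes the possible outputs of the algorithm on \<open>I\<close>. All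
  deterministic optima have the same value, so the choice of \<open>T\<close> is immaterial.\<close>

definition fails_better_than :: "cc_instance \<Rightarrow> (nat set \<Rightarrow> bool) \<Rightarrow> real \<Rightarrow> bool" where
  "fails_better_than I out r \<longleftrightarrow>
     (\<exists>S T. out S \<and> det_optimal I T \<and> objective I S \<le> r * objective I T)"

definition linear_instance :: "nat \<Rightarrow> nat \<Rightarrow> real \<Rightarrow> real \<Rightarrow> real \<Rightarrow> cc_instance" where
  "linear_instance \<epsilon> n \<alpha> \<gamma> \<beta> =
     \<lparr> ground_size = n,
       objective = (\<lambda>X. (\<Sum>i=1..\<epsilon>. of_bool (i \<in> X)) + real \<epsilon> * (\<Sum>i=\<epsilon>+1..n. of_bool (i \<in> X))),
       halfwidth = (\<lambda>i. if i \<le> \<epsilon> then sqrt (\<gamma> / real \<epsilon>)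
                        else sqrt ((real \<epsilon> * \<gamma> + \<beta>) / real \<epsilon>)),
       budget = real \<epsilon> + 1,
       threshold = \<alpha> \<rparr>"

end

theory Submission
  imports Defs
begin

text \<open>The first \<open>\<epsilon>\<close> elements have gain ratio \<open>\<epsilon> / \<gamma>\<close>, which exceeds the ratio
  \<open>\<epsilon>\<^sup>2 / (\<epsilon>\<gamma> + \<beta>)\<close> of the others, so the greedy loop takes them first. They all fit, because
  their standard deviation term is at most \<open>1\<close>, and afterwards nothing else fits: every set of
  \<open>\<epsilon> + 1\<close> elements already has mean \<open>B\<close>, and its standard deviation is positive. The loop thus
  ends with value \<open>\<epsilon>\<close>, which no single element exceeds, while \<open>\<epsilon>\<close> of the other elements are worth
  \<open>\<epsilon>\<^sup>2\<close>.\<close>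

lemma AE_weight_distr_le:
  assumes "0 \<le> d"
  shows "AE x in weight_distr d. x \<le> 1 + d"
proof (cases "d = 0")
  case True
  have "AE x in return borel (1::real). x \<le> 1" by (subst AE_return) auto
  then show ?thesis unfolding weight_distr_def True by simp
next
  case False
  have "AE x in uniform_measure lborel {1 - d..1 + d}. x \<le> 1 + d"
    by (rule AE_uniform_measureI) auto
  then show ?thesis unfolding weight_distr_def using False by simp
qed

text \<open>The weight of \<open>i\<close> is almost surely at most
  \<open>1 + halfwidth I i\<close>, hence within the budget, so the overflow event has probability
  0.\<close>

lemma chance_feasible_singleton:
  assumes nonneg: "\<forall>j\<in>ground I. 0 \<le> halfwidth I j" and i: "i \<in> ground I"
    and "1 + halfwidth I i \<le> budget I" and "0 \<le> threshold I"
  shows "chance_feasible I {i}"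
proof -
  have "AE w in weight_space I. w i \<le> 1 + halfwidth I i"
    unfolding weight_space_def
    using nonneg i by (intro AE_PiM_component AE_weight_distr_le weight_distr_moments(1)) auto
  then have ae: "AE w in weight_space I. \<not> total_weight {i} w > budget I"
    by eventually_elim (use assms in \<open>simp add: total_weight_def\<close>)
  have "\<P>(w in weight_space I. total_weight {i} w > budget I) = 0"
  \<comment> \<open>\<open>measure\<close> is 0 by convention outside the sigma-algebra, so both
    cases give 0.\<close>
  proof (cases "{w \<in> space (weight_space I). total_weight {i} w > budget I} \<in> sets (weight_space I)")
    case True
    with ae show ?thesis
      using AE_iff_null[of "weight_space I" "\<lambda>w. \<not> total_weight {i} w > budget I"]
      by (simp add: measure_eq_0_null_sets)
  qed (rule measure_notin_sets)
  with assms show ?thesis by (simp add: chance_feasible_def)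
qed

lemma monotone_set_fun_sum:
  assumes "finite V" and "\<And>i. i \<in> V \<Longrightarrow> 0 \<le> c i"
  shows "monotone_set_fun V (\<lambda>X. \<Sum>i\<in>X. c i)"
  unfolding monotone_set_fun_def
  using assms by (auto intro!: sum_mono2 intro: finite_subset)

lemma submodular_sum:
  assumes "finite V"
  shows "submodular V (\<lambda>X. \<Sum>i\<in>X. c i)"
  unfolding submodular_def using assms by (metis finite_subset order_refl sum.union_inter)

text \<open>The admissible sets form a finite family containing the empty set; a maximizer is found
  as a minimizer of the negated objective.\<close>

lemma det_optimal_exists:
  assumes "0 \<le> budget I"
  shows "\<exists>T. det_optimal I T"
proof -
  let ?F = "{S. S \<subseteq> ground I \<and> int (card S) \<le> \<lfloor>budget I\<rfloor>}"
  have "finite ?F" by (rule finite_subset[of _ "Pow (ground I)"]) (auto simp: ground_def)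
  moreover have "{} \<in> ?F" using assms by simp
  ultimately obtain T where "is_arg_min (\<lambda>S. - objective I S) (\<lambda>S. S \<in> ?F) T"
    using ex_is_arg_min_if_finite[of ?F "\<lambda>S. - objective I S"] by blast
  then show ?thesis by (auto simp: det_optimal_def is_arg_max_def is_arg_min_def)
qed

text \<open>\<open>deviation\<close> will bound the standard deviation term of the first \<epsilon>
  elements by 1. \<open>halfwidth_le\<close> keeps the larger half-width at most 1, as a valid
  instance requires.\<close>

locale linear_instance_params =
  fixes \<epsilon> n :: nat and \<alpha> \<gamma> \<beta> :: real
  assumes \<epsilon>: "1 \<le> \<epsilon>" and n: "2 * \<epsilon> \<le> n"
    and \<alpha>: "0 < \<alpha>" "\<alpha> < 1" and \<gamma>: "0 < \<gamma>" and \<beta>: "0 < \<beta>"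
    and deviation: "real \<epsilon> * \<gamma> + \<beta> \<le> 3 * \<alpha> / (1 - \<alpha>)"
    and halfwidth_le: "real \<epsilon> * \<gamma> + \<beta> \<le> real \<epsilon>"
begin

definition I :: cc_instance where
  "I = linear_instance \<epsilon> n \<alpha> \<gamma> \<beta>"

definition value_of :: "nat \<Rightarrow> real" where
  "value_of i = (if i \<le> \<epsilon> then 1 else real \<epsilon>)"

text \<open>The function h of the greedy rule. On subsets of the ground set it is three times the
  variance of the total weight.\<close>

definition cost :: "nat set \<Rightarrow> real" where
  "cost S = (\<Sum>i\<in>S. (halfwidth I i)\<^sup>2)"

lemma I_simps [simp]:
  "ground I = {1..n}" "budget I = real \<epsilon> + 1" "threshold I = \<alpha>"
  by (auto simp: I_def linear_instance_def ground_def)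

text \<open>The objective ignores indices outside \<open>{1..n}\<close>, hence the restriction on
  \<open>X\<close>. Being additive, it is modular, and marginal gains do not depend on the current
  solution.\<close>

lemma objective_eq:
  assumes "X \<subseteq> {1..n}"
  shows "objective I X = (\<Sum>i\<in>X. value_of i)"
proof -
  have "(\<Sum>i\<in>X. value_of i) = (\<Sum>i=1..n. of_bool (i \<in> X) * value_of i)"
    using assms by (intro sum.mono_neutral_cong_left) auto
  also have "{1..n} = {1..\<epsilon>} \<union> {\<epsilon>+1..n}" using n by auto
  also have "(\<Sum>i\<in>\<dots>. of_bool (i \<in> X) * value_of i) =
      (\<Sum>i=1..\<epsilon>. of_bool (i \<in> X) * value_of i) + (\<Sum>i=\<epsilon>+1..n. of_bool (i \<in> X) * value_of i)"
    by (rule sum.union_disjoint) auto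
  also have "\<dots> = objective I X"
    by (simp add: I_def linear_instance_def value_of_def sum_distrib_left mult.commute)
  finally show ?thesis by simp
qed

lemma halfwidth_square:
  "(halfwidth I i)\<^sup>2 = (if i \<le> \<epsilon> then \<gamma> / real \<epsilon> else (real \<epsilon> * \<gamma> + \<beta>) / real \<epsilon>)"
  using \<epsilon> \<gamma> \<beta> by (simp add: I_def linear_instance_def)

lemma halfwidth_square_pos: "0 < (halfwidth I i)\<^sup>2"
  using \<epsilon> \<gamma> \<beta> by (simp add: halfwidth_square add_pos_pos)

lemma halfwidth_nonneg: "0 \<le> halfwidth I i"
  using \<gamma> \<beta> by (simp add: I_def linear_instance_def)

lemma halfwidth_le_1: "halfwidth I i \<le> 1"
proof -
  have "\<gamma> \<le> real \<epsilon> * \<gamma>" using \<epsilon> \<gamma> by simp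
  then have "\<gamma> \<le> real \<epsilon>" using halfwidth_le \<beta> by linarith
  then show ?thesis using \<epsilon> halfwidth_le by (simp add: I_def linear_instance_def)
qed

lemma chance_feasible_element: "i \<in> {1..n} \<Longrightarrow> chance_feasible I {i}"
  using halfwidth_le_1[of i] \<epsilon> \<alpha>
  by (intro chance_feasible_singleton) (auto simp: halfwidth_nonneg)

lemma valid: "valid_instance I"
proof -
  have c: "0 \<le> value_of i" for i by (simp add: value_of_def)
  have "monotone_set_fun {1..n} (objective I)"
    using monotone_set_fun_sum[of "{1..n}" value_of] c
    by (auto simp: monotone_set_fun_def objective_eq subset_trans)
  moreover have "submodular {1..n} (objective I)"
    using submodular_sum[of "{1..n}" value_of]
    by (auto simp: submodular_def objective_eq le_infI1)
  ultimately show ?thesis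
    using c \<epsilon> \<alpha> unfolding valid_instance_def
    by (auto simp: objective_eq sum_nonneg halfwidth_nonneg halfwidth_le_1 chance_feasible_element)
qed

lemma surrogate_I:
  assumes "S \<subseteq> {1..n}"
  shows "surrogate I S = real (card S) + kappa \<alpha> * sqrt (cost S / 3)"
  using surrogate_eq[of I S] assms halfwidth_nonneg by (simp add: cost_def sum_divide_distrib)

lemma surrogate_small:
  assumes "k \<le> \<epsilon>"
  shows "surrogate I {1..k} \<le> real \<epsilon> + 1"
proof -
  have "cost {1..k} = real k * (\<gamma> / real \<epsilon>)"
    using assms by (simp add: cost_def halfwidth_square)
  also have "\<dots> \<le> real \<epsilon> * (\<gamma> / real \<epsilon>)"
    using assms \<gamma> by (intro mult_right_mono) auto
  also have "\<dots> \<le> real \<epsilon> * \<gamma> + \<beta>" using \<epsilon> \<gamma> \<beta> by (simp add: add_increasing2)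
  also have "\<dots> \<le> 3 * \<alpha> / (1 - \<alpha>)" by (rule deviation)
  finally have "cost {1..k} \<le> 3 * \<alpha> / (1 - \<alpha>)" .
  \<comment> \<open>The left side is the square of the standard deviation term; the 3 in
    \<open>deviation\<close> cancels the 3 of the uniform variance.\<close>
  then have "(1 - \<alpha>) / \<alpha> * (cost {1..k} / 3) \<le> 1"
    using \<alpha> by (simp add: field_simps)
  then have "kappa \<alpha> * sqrt (cost {1..k} / 3) \<le> 1"
    unfolding kappa_def real_sqrt_mult[symmetric] by simp
  then show ?thesis using assms n by (simp add: surrogate_I)
qed

lemma surrogate_large:
  assumes "S \<subseteq> {1..n}" and "card S = \<epsilon> + 1"
  shows "real \<epsilon> + 1 < surrogate I S"
proof -
  have "0 < cost S" unfolding cost_def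
    using assms halfwidth_square_pos by (intro sum_pos) (auto intro: card_ge_0_finite)
  moreover have "0 < kappa \<alpha>" using \<alpha> by (simp add: kappa_def)
  ultimately show ?thesis using assms by (simp add: surrogate_I)
qed

text \<open>Objective and cost are both additive, so the ratio is value over squared half-width,
  whatever \<open>S\<close> is.\<close>

lemma gain_ratio_eq:
  assumes "S \<subseteq> {1..n}" "v \<in> {1..n}" "v \<notin> S"
  shows "gain_ratio I cost S v =
    (if v \<le> \<epsilon> then real \<epsilon> / \<gamma> else real \<epsilon> * real \<epsilon> / (real \<epsilon> * \<gamma> + \<beta>))"
proof -
  have "finite S" using assms(1) finite_subset by blast
  then have "gain_ratio I cost S v = value_of v / (halfwidth I v)\<^sup>2"
    using assms by (simp add: gain_ratio_def objective_eq cost_def)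
  then show ?thesis by (simp add: halfwidth_square value_of_def)
qed

text \<open>After cross-multiplication this is 0 < \<beta>.\<close>

lemma gain_ratio_less: "real \<epsilon> * real \<epsilon> / (real \<epsilon> * \<gamma> + \<beta>) < real \<epsilon> / \<gamma>"
  using \<epsilon> \<gamma> \<beta> by (simp add: field_simps add_pos_pos)

text \<open>The first \<epsilon> elements tie for the largest ratio; \<open>gga_reach\<close> admits
  any tie-breaking, and increasing index order is chosen.\<close>

lemma gga_reach_small: "k \<le> \<epsilon> \<Longrightarrow> gga_reach I cost {1..k} {k+1..n}"
proof (induction k)
  case 0
  then show ?case using gga_reach.start[of I cost] by simp
next
  case (Suc k)
  have ins: "{1..k} \<union> {Suc k} = {1..Suc k}" by auto
  have "is_arg_max (gain_ratio I cost {1..k}) (\<lambda>v. v \<in> {k+1..n}) (Suc k)"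
    using Suc.prems n gain_ratio_less by (auto simp: is_arg_max_linorder gain_ratio_eq)
  from gga_reach.add[OF Suc.IH this] Suc.prems
  have "gga_reach I cost {1..Suc k} ({k+1..n} - {Suc k})"
    unfolding ins using surrogate_small[of "Suc k"] by simp
  moreover have "{k+1..n} - {Suc k} = {Suc k + 1..n}" by auto
  ultimately show ?case by simp
qed

lemma gga_reach_large: "\<epsilon> + k \<le> n \<Longrightarrow> gga_reach I cost {1..\<epsilon>} {\<epsilon>+k+1..n}"
proof (induction k)
  case 0
  then show ?case using gga_reach_small[of \<epsilon>] by simp
next
  case (Suc k)
  let ?v = "\<epsilon> + k + 1"
  \<comment> \<open>All remaining candidates exceed \<epsilon> and share one ratio, so the smallest
    is a maximizer.\<close>
  have arg: "is_arg_max (gain_ratio I cost {1..\<epsilon>}) (\<lambda>v. v \<in> {\<epsilon>+k+1..n}) ?v"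
    using Suc.prems by (auto simp: is_arg_max_linorder gain_ratio_eq)
  have "\<not> surrogate I ({1..\<epsilon>} \<union> {?v}) \<le> budget I"
    using surrogate_large[of "{1..\<epsilon>} \<union> {?v}"] Suc.prems by simp
  with Suc arg have "gga_reach I cost {1..\<epsilon>} ({\<epsilon>+k+1..n} - {?v})"
    by (intro gga_reach.skip) auto
  moreover have "{\<epsilon>+k+1..n} - {?v} = {\<epsilon>+Suc k+1..n}" by auto
  ultimately show ?case by simp
qed

lemma gga_output_small: "gga_output I cost {1..\<epsilon>}"
proof -
  have reach: "gga_reach I cost {1..\<epsilon>} {}"
    using gga_reach_large[of "n - \<epsilon>"] n by simp
  have single: "objective I {v} = value_of v" if "v \<in> {1..n}" for v
    using that by (simp add: objective_eq)
  have best: "is_arg_max (\<lambda>v. objective I {v}) (\<lambda>v. v \<in> ground I \<and> chance_feasible I {v}) n"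
    using \<epsilon> n by (auto simp: is_arg_max_linorder single chance_feasible_element value_of_def)
  have "objective I {1..\<epsilon>} = real \<epsilon>"
    using n by (simp add: objective_eq value_of_def)
  \<comment> \<open>Both sets are worth \<epsilon>, because n > \<epsilon>; the tie allows the
    loop's set to be the output.\<close>
  then have "is_arg_max (objective I) (\<lambda>X. X \<in> {{1..\<epsilon>}, {n}}) {1..\<epsilon>}"
    using \<epsilon> n by (auto simp: is_arg_max_linorder single value_of_def)
  with reach best show ?thesis unfolding gga_output_def by blast
qed

lemma det_optimal_ge:
  assumes "det_optimal I T"
  shows "real \<epsilon> * real \<epsilon> \<le> objective I T"
proof -
  \<comment> \<open>These \<epsilon> elements exist because n is at least 2\<epsilon>. The budget
    admits one more, so this is only a lower bound on the optimum.\<close>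
  have "objective I {\<epsilon>+1..2*\<epsilon>} \<le> objective I T"
    using assms n by (auto simp: det_optimal_def is_arg_max_linorder)
  moreover have "objective I {\<epsilon>+1..2*\<epsilon>} = real \<epsilon> * real \<epsilon>"
    using n by (simp add: objective_eq value_of_def)
  ultimately show ?thesis by simp
qed

lemma gga_fails: "fails_better_than I (gga_output I cost) (1 / real \<epsilon>)"
proof -
  obtain T where T: "det_optimal I T"
    using det_optimal_exists[of I] by auto
  have "objective I {1..\<epsilon>} \<le> 1 / real \<epsilon> * objective I T"
    using det_optimal_ge[OF T] \<epsilon> n by (simp add: objective_eq value_of_def field_simps)
  with T gga_output_small show ?thesis unfolding fails_better_than_def by blast
qed

end

theorem theorem3:
  fixes \<epsilon> :: nat
  assumes "\<epsilon> \<ge> 1"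
  shows "\<exists>(n::nat) (\<alpha>::real) (\<gamma>::real) (\<beta>::real) I.
    n \<ge> 2 * \<epsilon> \<and> 0 < \<alpha> \<and> \<alpha> < 1 / 2 \<and>
    \<gamma> > 0 \<and> \<beta> > 0 \<and> real \<epsilon> * \<gamma> + \<beta> \<le> 3 * \<alpha> / (1 - \<alpha>) \<and>
    I = linear_instance \<epsilon> n \<alpha> \<gamma> \<beta> \<and>
    valid_instance I \<and>
    fails_better_than I (gga_output I (\<lambda>S. \<Sum>i\<in>S. (halfwidth I i)\<^sup>2)) (1 / real \<epsilon>)"
proof -
  \<comment> \<open>With \<alpha> = 1/4 the bound 3\<alpha>/(1-\<alpha>) is 1, and \<gamma>, \<beta>
    are chosen so that \<epsilon>\<gamma> + \<beta> = 1/2 + 1/2 meets it with equality;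
    \<open>halfwidth_le\<close> then reads 1 \<le> \<epsilon>.\<close>
  let ?n = "2 * \<epsilon>" and ?\<alpha> = "1 / 4 :: real" and ?\<gamma> = "1 / (2 * real \<epsilon>)" and ?\<beta> = "1 / 2 :: real"
  interpret P: linear_instance_params \<epsilon> ?n ?\<alpha> ?\<gamma> ?\<beta>
    using assms by unfold_locales auto
  have cost: "P.cost = (\<lambda>S. \<Sum>i\<in>S. (halfwidth P.I i)\<^sup>2)"
    by (rule ext) (rule P.cost_def)
  show ?thesis
    using P.n P.\<gamma> P.\<beta> P.deviation P.valid P.gga_fails[unfolded cost]
    by (intro exI[of _ ?n] exI[of _ ?\<alpha>] exI[of _ ?\<gamma>] exI[of _ ?\<beta>] exI[of _ P.I])
      (simp add: P.I_def)
qed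

end
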